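(* Let $T\in V_1\otimes V_2\otimes V_3$ be a (possibly not tight) tensor with a blocking $f_i\colon\mathcal{B}_i\to\mathbb{Z}^r$, $i=1,2,3$. Fix a $\mathbb{K}^*$-action on each $V_i$ for which the basis vectors in $\mathcal{B}_i$ are eigenvectors and the integer weight of $e\in\mathcal{B}_i$ depends only on $f_i(e)$; write it $w(e)=w(f_i(e))$. Give the block indexed by $(a_1,a_2,a_3)$ the weight $w(a_1)+w(a_2)+w(a_3)$, and assume that all nonzero blocks of $T$ have non-negative weight. Let $T'=\lim_{t\to0}t\cdot T$ be the resulting toric degeneration of $T$. Assume that $T'$ (with the same blocking) is tight, that $P$ is a probability distribution on the blocks in the support of $T'$ which is reconstructable from its three marginals, that all three marginals of $P$ are the same distribution, and that $N$ is a positive integer such that $N\cdot P$ is integral. If $SP_{P,N}(T')\neq0$, then $SP_{P,N}(T)=SP_{P,N}(T')$.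
   Context: $\mathbb{K}$ is an algebraically closed field of characteristic zero. A blocking of $T\in V_1\otimes V_2\otimes V_3$ is a triple of functions $f_i\colon\mathcal{B}_i\to\mathbb{Z}^r$, where $\mathcal{B}_i$ is a basis of $V_i$. The block $T_{a_1,a_2,a_3}$ is the image of $T$ under the coordinate projection $V_1\otimes V_2\otimes V_3\to V_1'\otimes V_2'\otimes V_3'$, with $V_i'=\langle b\in\mathcal{B}_i: f_i(b)=a_i\rangle$; the block is in the support of $T$ if it is nonzero. $T$ with a blocking is tight if $a_1+a_2+a_3=0$ for every $(a_1,a_2,a_3)$ in the support. The weight function $w$ may be different for the three factors. The degeneration $T'$ is thus the sum of the weight-zero blocks of $T$. A probability distribution $P$ on the support has marginals $P_i$, distributions on $\mathbb{Z}^r$ (supported on the image of $f_i$), e.g. $P_1(a)=\sum_{(a,b,c)}P(a,b,c)$. $P$ is reconstructable from its marginals if it is the only probability distribution on the support with these three marginals. $SP_{P,N}(T)$ (and likewise $SP_{P,N}(T')$) is the image of the Kronecker power $T^{\boxtimes N}\in V_1^{\otimes N}\otimes V_2^{\otimes N}\otimes V_3^{\otimes N}$ under the coordinate projection keeping, in the $i$-th factor, exactly the basis vectors $b_1\otimes\cdots\otimes b_N$ ($b_j\in\mathcal{B}_i$) such that each $a$ occurs exactly $N\cdot P_i(a)$ times in the sequence $(f_i(b_1),\ldots,f_i(b_N))$. *)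

theory Defs
  imports "HOL-Probability.Probability" "HOL-Computational_Algebra.Polynomial"
begin

text \<open>
  For finite-dimensional spaces with bases \<open>B1\<close>, \<open>B2\<close>, \<open>B3\<close>, an element of the tensor product of
  the three spaces is represented by its array of coordinates with respect to the product basis:
  \<open>T x y z\<close> is the coefficient at the tensor product of \<open>x\<close>, \<open>y\<close>, \<open>z\<close>. An array is extended by zero
  outside \<open>B1 \<times> B2 \<times> B3\<close>, so equality of tensors is equality of functions. The \<open>N\<close>-th tensor power
  of a space with basis \<open>B\<close> has as basis the lists of length \<open>N\<close> over \<open>B\<close>.
\<close>

type_synonym ('x, 'y, 'z, 'k) tensor = "'x \<Rightarrow> 'y \<Rightarrow> 'z \<Rightarrow> 'k"

definition tensor_space ::
  "'x set \<Rightarrow> 'y set \<Rightarrow> 'z set \<Rightarrow> ('x, 'y, 'z, 'k::zero) tensor set" where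
  "tensor_space B1 B2 B3 =
     {T. \<forall>x y z. T x y z \<noteq> 0 \<longrightarrow> x \<in> B1 \<and> y \<in> B2 \<and> z \<in> B3}"

definition coord_proj ::
  "'x set \<Rightarrow> 'y set \<Rightarrow> 'z set \<Rightarrow> ('x, 'y, 'z, 'k::zero) tensor \<Rightarrow> ('x, 'y, 'z, 'k) tensor" where
  "coord_proj X Y Z T = (\<lambda>x y z. if x \<in> X \<and> y \<in> Y \<and> z \<in> Z then T x y z else 0)"

text \<open>
  The tensor product of the linear endomorphisms \<open>A1\<close>, \<open>A2\<close>, \<open>A3\<close> applied to \<open>T\<close>: the array \<open>T\<close>
  stands for the sum of \<open>T x' y' z'\<close> times the tensor product of \<open>x'\<close>, \<open>y'\<close>, \<open>z'\<close>, and each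
  basis vector is mapped and then expanded again in the basis.
\<close>

definition tensor_map ::
  "('k::field \<Rightarrow> 'x::ab_group_add \<Rightarrow> 'x) \<Rightarrow> ('k \<Rightarrow> 'y::ab_group_add \<Rightarrow> 'y) \<Rightarrow>
   ('k \<Rightarrow> 'z::ab_group_add \<Rightarrow> 'z) \<Rightarrow> 'x set \<Rightarrow> 'y set \<Rightarrow> 'z set \<Rightarrow>
   ('x \<Rightarrow> 'x) \<Rightarrow> ('y \<Rightarrow> 'y) \<Rightarrow> ('z \<Rightarrow> 'z) \<Rightarrow> ('x, 'y, 'z, 'k) tensor \<Rightarrow> ('x, 'y, 'z, 'k) tensor" where
  "tensor_map s1 s2 s3 B1 B2 B3 A1 A2 A3 T = (\<lambda>x y z.
     \<Sum>x'\<in>B1. \<Sum>y'\<in>B2. \<Sum>z'\<in>B3. T x' y' z' *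
       (module.representation s1 B1 (A1 x') x *
        module.representation s2 B2 (A2 y') y *
        module.representation s3 B3 (A3 z') z))"

text \<open>A linear action of the multiplicative group of the field; \<open>\<rho> 0\<close> is irrelevant.\<close>

definition mult_group_action ::
  "('k::field \<Rightarrow> 'v::ab_group_add \<Rightarrow> 'v) \<Rightarrow> ('k \<Rightarrow> 'v \<Rightarrow> 'v) \<Rightarrow> bool" where
  "mult_group_action s \<rho> \<longleftrightarrow>
     (\<forall>t. t \<noteq> 0 \<longrightarrow> Vector_Spaces.linear s s (\<rho> t)) \<and>
     (\<forall>v. \<rho> 1 v = v) \<and>
     (\<forall>t u v. t \<noteq> 0 \<longrightarrow> u \<noteq> 0 \<longrightarrow> \<rho> (t * u) v = \<rho> t (\<rho> u v))"

text \<open>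
  The field carries no topology, so the limit for \<open>t \<rightarrow> 0\<close> is the algebraic one: the map
  \<open>t \<mapsto> g t\<close> on nonzero \<open>t\<close> extends to a morphism from the affine line (i.e. every coordinate is
  given by a polynomial in \<open>t\<close>), and \<open>L\<close> is the value of the extension at \<open>0\<close>. Over an infinite
  field such an \<open>L\<close> is unique.
\<close>

definition tensor_limit_at_0 ::
  "('k::field \<Rightarrow> ('x, 'y, 'z, 'k) tensor) \<Rightarrow> ('x, 'y, 'z, 'k) tensor \<Rightarrow> bool" where
  "tensor_limit_at_0 g L \<longleftrightarrow>
     (\<forall>x y z. \<exists>p. (\<forall>t. t \<noteq> 0 \<longrightarrow> g t x y z = poly p t) \<and> L x y z = poly p 0)"

definition block ::
  "'x set \<Rightarrow> 'y set \<Rightarrow> 'z set \<Rightarrow> ('x \<Rightarrow> 'a) \<Rightarrow> ('y \<Rightarrow> 'a) \<Rightarrow> ('z \<Rightarrow> 'a) \<Rightarrow>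
   ('x, 'y, 'z, 'k::zero) tensor \<Rightarrow> 'a \<times> 'a \<times> 'a \<Rightarrow> ('x, 'y, 'z, 'k) tensor" where
  "block B1 B2 B3 f1 f2 f3 T = (\<lambda>(a1, a2, a3).
     coord_proj {x\<in>B1. f1 x = a1} {y\<in>B2. f2 y = a2} {z\<in>B3. f3 z = a3} T)"

definition block_support ::
  "'x set \<Rightarrow> 'y set \<Rightarrow> 'z set \<Rightarrow> ('x \<Rightarrow> 'a) \<Rightarrow> ('y \<Rightarrow> 'a) \<Rightarrow> ('z \<Rightarrow> 'a) \<Rightarrow>
   ('x, 'y, 'z, 'k::zero) tensor \<Rightarrow> ('a \<times> 'a \<times> 'a) set" where
  "block_support B1 B2 B3 f1 f2 f3 T =
     {a. block B1 B2 B3 f1 f2 f3 T a \<noteq> (\<lambda>_ _ _. 0)}"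

definition tight_blocking ::
  "'x set \<Rightarrow> 'y set \<Rightarrow> 'z set \<Rightarrow> ('x \<Rightarrow> 'a::ab_group_add) \<Rightarrow> ('y \<Rightarrow> 'a) \<Rightarrow> ('z \<Rightarrow> 'a) \<Rightarrow>
   ('x, 'y, 'z, 'k::zero) tensor \<Rightarrow> bool" where
  "tight_blocking B1 B2 B3 f1 f2 f3 T \<longleftrightarrow>
     (\<forall>(a1, a2, a3) \<in> block_support B1 B2 B3 f1 f2 f3 T. a1 + a2 + a3 = 0)"

definition marginal1 :: "('a \<times> 'a \<times> 'a) pmf \<Rightarrow> 'a pmf" where
  "marginal1 P = map_pmf (\<lambda>(a1, a2, a3). a1) P"

definition marginal2 :: "('a \<times> 'a \<times> 'a) pmf \<Rightarrow> 'a pmf" where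
  "marginal2 P = map_pmf (\<lambda>(a1, a2, a3). a2) P"

definition marginal3 :: "('a \<times> 'a \<times> 'a) pmf \<Rightarrow> 'a pmf" where
  "marginal3 P = map_pmf (\<lambda>(a1, a2, a3). a3) P"

definition reconstructable :: "('a \<times> 'a \<times> 'a) set \<Rightarrow> ('a \<times> 'a \<times> 'a) pmf \<Rightarrow> bool" where
  "reconstructable S P \<longleftrightarrow>
     (\<forall>Q. set_pmf Q \<subseteq> S \<longrightarrow> marginal1 Q = marginal1 P \<longrightarrow> marginal2 Q = marginal2 P \<longrightarrow>
          marginal3 Q = marginal3 P \<longrightarrow> Q = P)"

definition kronecker_power ::
  "nat \<Rightarrow> ('x, 'y, 'z, 'k::comm_semiring_1) tensor \<Rightarrow> ('x list, 'y list, 'z list, 'k) tensor" where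
  "kronecker_power N T = (\<lambda>xs ys zs.
     if length xs = N \<and> length ys = N \<and> length zs = N
     then \<Prod>j<N. T (xs ! j) (ys ! j) (zs ! j) else 0)"

definition typical_words :: "'v set \<Rightarrow> ('v \<Rightarrow> 'a) \<Rightarrow> 'a pmf \<Rightarrow> nat \<Rightarrow> 'v list set" where
  "typical_words B f p N =
     {bs \<in> lists B. length bs = N \<and>
        (\<forall>a. real (count_list (map f bs) a) = real N * pmf p a)}"

definition SP ::
  "'x set \<Rightarrow> 'y set \<Rightarrow> 'z set \<Rightarrow> ('x \<Rightarrow> 'a) \<Rightarrow> ('y \<Rightarrow> 'a) \<Rightarrow> ('z \<Rightarrow> 'a) \<Rightarrow>
   ('a \<times> 'a \<times> 'a) pmf \<Rightarrow> nat \<Rightarrow> ('x, 'y, 'z, 'k::comm_semiring_1) tensor \<Rightarrow>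
   ('x list, 'y list, 'z list, 'k) tensor" where
  "SP B1 B2 B3 f1 f2 f3 P N T =
     coord_proj (typical_words B1 f1 (marginal1 P) N)
                (typical_words B2 f2 (marginal2 P) N)
                (typical_words B3 f3 (marginal3 P) N)
                (kronecker_power N T)"

end

theory Submission
  imports Defs
begin

text \<open>
  The total weight of a triple of words depends only on the letter counts, so it takes the same
  value on all triples that survive the projection. A nonzero coordinate of the projected power of
  \<open>T'\<close> uses only weight-zero blocks, so this value is 0. For \<open>T\<close>, whose blocks have non-negative
  weight, a nonzero coordinate then also uses only weight-zero blocks, and there \<open>T\<close> and \<open>T'\<close> agree.
\<close>

lemma representation_scaled_basis:
  assumes "vector_space s" and "module.independent s B" and "b \<in> B"
  shows "module.representation s B (s c b) x = (if x = b then c else 0)"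
proof -
  interpret vector_space s by fact
  show ?thesis
    using assms by (auto simp: representation_scale representation_basis span_base)
qed

text \<open>Each factor acts on its basis by scalars, so the tensor product of the three maps has a
  diagonal matrix in the product basis and the triple sum collapses to a single term.\<close>

lemma tensor_map_diagonal:
  assumes "finite_dimensional_vector_space s1 B1"
    and "finite_dimensional_vector_space s2 B2"
    and "finite_dimensional_vector_space s3 B3"
    and "T \<in> tensor_space B1 B2 B3"
    and "\<And>e. e \<in> B1 \<Longrightarrow> A1 e = s1 (c1 e) e"
    and "\<And>e. e \<in> B2 \<Longrightarrow> A2 e = s2 (c2 e) e"
    and "\<And>e. e \<in> B3 \<Longrightarrow> A3 e = s3 (c3 e) e"
  shows "tensor_map s1 s2 s3 B1 B2 B3 A1 A2 A3 T x y z = T x y z * (c1 x * c2 y * c3 z)"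
proof -
  interpret V1: finite_dimensional_vector_space s1 B1 by fact
  interpret V2: finite_dimensional_vector_space s2 B2 by fact
  interpret V3: finite_dimensional_vector_space s3 B3 by fact
  have fin: "finite B1" "finite B2" "finite B3"
    by (rule V1.finite_Basis V2.finite_Basis V3.finite_Basis)+
  have rep1: "V1.representation B1 (A1 e) x = (if e = x then c1 x else 0)" if "e \<in> B1" for e
    using that assms(5) representation_scaled_basis[OF V1.vector_space_axioms V1.independent_Basis]
    by auto
  have rep2: "V2.representation B2 (A2 e) y = (if e = y then c2 y else 0)" if "e \<in> B2" for e
    using that assms(6) representation_scaled_basis[OF V2.vector_space_axioms V2.independent_Basis]
    by auto
  have rep3: "V3.representation B3 (A3 e) z = (if e = z then c3 z else 0)" if "e \<in> B3" for e
    using that assms(7) representation_scaled_basis[OF V3.vector_space_axioms V3.independent_Basis]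
    by auto
  \<comment> \<open>The condition on \<open>z'\<close> stands outermost because the sum over
    \<open>z'\<close> is innermost: the three sums then collapse one after the other.\<close>
  have "tensor_map s1 s2 s3 B1 B2 B3 A1 A2 A3 T x y z =
      (\<Sum>x'\<in>B1. \<Sum>y'\<in>B2. \<Sum>z'\<in>B3. if z' = z then if y' = y then if x' = x
        then T x y z * (c1 x * c2 y * c3 z) else 0 else 0 else 0)"
    unfolding tensor_map_def by (intro sum.cong refl) (simp add: rep1 rep2 rep3)
  also have "\<dots> = (if x \<in> B1 \<and> y \<in> B2 \<and> z \<in> B3 then T x y z * (c1 x * c2 y * c3 z) else 0)"
    by (cases "z \<in> B3"; cases "y \<in> B2") (simp_all add: fin)
  \<comment> \<open>Outside the product of the bases both sides are 0, as \<open>T\<close> is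
    extended by zero there.\<close>
  also have "\<dots> = T x y z * (c1 x * c2 y * c3 z)"
    using assms(4) by (auto simp: tensor_space_def)
  finally show ?thesis .
qed

text \<open>Multiplication by the indeterminate forces agreement at 0 as well. Over an infinite
  field equal polynomial functions come from equal polynomials, and the factor can be
  cancelled.\<close>

lemma poly_eqI_nonzero:
  fixes p q :: "'k::field_char_0 poly"
  assumes "\<And>t. t \<noteq> 0 \<Longrightarrow> poly p t = poly q t"
  shows "p = q"
proof -
  have "poly ([:0, 1:] * p) t = poly ([:0, 1:] * q) t" for t
    using assms by (cases "t = 0") auto
  then have "[:0, 1:] * p = [:0, 1:] * q"
    by (simp add: poly_eq_poly_eq_iff[symmetric] fun_eq_iff)
  then show ?thesis
    by simp
qed

text \<open>For nonzero \<open>c\<close> the exponent is non-negative, so \<open>p\<close> must be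
  the monomial of that degree, whose value at 0 survives only in degree 0. For \<open>c = 0\<close>
  the exponent may be negative, but then \<open>p\<close> is 0.\<close>

lemma poly_0_of_powi:
  fixes p :: "'k::field_char_0 poly"
  assumes "\<And>t. t \<noteq> 0 \<Longrightarrow> poly p t = c * t powi n" and "c \<noteq> 0 \<Longrightarrow> 0 \<le> n"
  shows "poly p 0 = (if n = 0 then c else 0)"
proof -
  have "p = monom c (nat n)"
    using assms by (intro poly_eqI_nonzero) (cases "c = 0"; auto simp: poly_monom power_int_def)
  then show ?thesis
    using assms(2) by (cases "c = 0") (auto simp: poly_monom)
qed

text \<open>This carries hypotheses about blocks over to single coordinates.\<close>

lemma block_support_nonzero_entry:
  assumes "T \<in> tensor_space B1 B2 B3" and "T x y z \<noteq> 0"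
  shows "(f1 x, f2 y, f3 z) \<in> block_support B1 B2 B3 f1 f2 f3 T"
proof -
  have "block B1 B2 B3 f1 f2 f3 T (f1 x, f2 y, f3 z) x y z \<noteq> 0"
    using assms by (auto simp: block_def coord_proj_def tensor_space_def)
  then show ?thesis
    by (auto simp: block_support_def fun_eq_iff)
qed

text \<open>The action multiplies each coordinate by \<open>t\<close> to the power of the weight of
  its block. As \<open>t\<close> tends to 0, positive powers vanish and weight-zero coordinates stay
  fixed, so the algebraic limit is the sum of the weight-zero blocks.\<close>

lemma toric_limit_entry:
  fixes T :: "('x::ab_group_add, 'y::ab_group_add, 'z::ab_group_add, 'k::field_char_0) tensor"
    and w1 w2 w3 :: "'a \<Rightarrow> int"
  assumes "finite_dimensional_vector_space s1 B1"
    and "finite_dimensional_vector_space s2 B2"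
    and "finite_dimensional_vector_space s3 B3"
    and T: "T \<in> tensor_space B1 B2 B3"
    and "\<And>t e. t \<noteq> 0 \<Longrightarrow> e \<in> B1 \<Longrightarrow> \<rho>1 t e = s1 (t powi w1 (f1 e)) e"
    and "\<And>t e. t \<noteq> 0 \<Longrightarrow> e \<in> B2 \<Longrightarrow> \<rho>2 t e = s2 (t powi w2 (f2 e)) e"
    and "\<And>t e. t \<noteq> 0 \<Longrightarrow> e \<in> B3 \<Longrightarrow> \<rho>3 t e = s3 (t powi w3 (f3 e)) e"
    and nonneg: "\<And>a1 a2 a3. (a1, a2, a3) \<in> block_support B1 B2 B3 f1 f2 f3 T \<Longrightarrow>
           w1 a1 + w2 a2 + w3 a3 \<ge> 0"
    and lim: "tensor_limit_at_0
           (\<lambda>t. tensor_map s1 s2 s3 B1 B2 B3 (\<rho>1 t) (\<rho>2 t) (\<rho>3 t) T) T'"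
  shows "T' x y z = (if w1 (f1 x) + w2 (f2 y) + w3 (f3 z) = 0 then T x y z else 0)"
proof -
  obtain p where p: "\<And>t. t \<noteq> 0 \<Longrightarrow>
      tensor_map s1 s2 s3 B1 B2 B3 (\<rho>1 t) (\<rho>2 t) (\<rho>3 t) T x y z = poly p t"
    and T': "T' x y z = poly p 0"
    using lim[unfolded tensor_limit_at_0_def, rule_format, of x y z] by metis
  have "poly p t = T x y z * t powi (w1 (f1 x) + w2 (f2 y) + w3 (f3 z))" if "t \<noteq> 0" for t
  proof -
    have "tensor_map s1 s2 s3 B1 B2 B3 (\<rho>1 t) (\<rho>2 t) (\<rho>3 t) T x y z =
        T x y z * (t powi w1 (f1 x) * t powi w2 (f2 y) * t powi w3 (f3 z))"
      using tensor_map_diagonal[OF assms(1-4), of "\<rho>1 t" "\<lambda>e. t powi w1 (f1 e)"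
          "\<rho>2 t" "\<lambda>e. t powi w2 (f2 e)" "\<rho>3 t" "\<lambda>e. t powi w3 (f3 e)"]
        assms(5-7)[OF that] by blast
    also have "\<dots> = T x y z * t powi (w1 (f1 x) + w2 (f2 y) + w3 (f3 z))"
      by (simp only: power_int_add[OF disjI1[OF that]])
    finally show ?thesis
      by (simp only: p[OF that])
  qed
  \<comment> \<open>The weight bound concerns only blocks in the support, hence the restriction to
    nonzero coordinates.\<close>
  moreover have "0 \<le> w1 (f1 x) + w2 (f2 y) + w3 (f3 z)" if "T x y z \<noteq> 0"
    by (rule nonneg) (rule block_support_nonzero_entry[OF T that])
  ultimately show ?thesis
    unfolding T' by (rule poly_0_of_powi)
qed

text \<open>The prescribed letter counts determine the multiset of labels of a word, and a sum over
  positions depends only on that multiset.\<close>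

lemma typical_words_sum_eq:
  fixes g :: "'a \<Rightarrow> 'b::comm_monoid_add"
  assumes "xs \<in> typical_words B f p N" and "ys \<in> typical_words B f p N"
  shows "(\<Sum>j<N. g (f (xs ! j))) = (\<Sum>j<N. g (f (ys ! j)))"
proof -
  have sum: "(\<Sum>j<N. g (f (us ! j))) = (\<Sum>a\<in>#mset (map f us). g a)"
    if "us \<in> typical_words B f p N" for us
  proof -
    have "length us = N"
      using that by (simp add: typical_words_def)
    then have "(\<Sum>j<N. g (f (us ! j))) = sum_list (map g (map f us))"
      by (simp add: sum_list_sum_nth atLeast0LessThan)
    then show ?thesis
      by (simp only: mset_map[symmetric] sum_mset_sum_list)
  qed
  have "real (count_list (map f xs) a) = real (count_list (map f ys) a)" for a
    using assms by (simp add: typical_words_def)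
  then have "mset (map f xs) = mset (map f ys)"
    by (intro multiset_eqI) (simp only: count_mset of_nat_eq_iff)
  then show ?thesis
    using assms by (simp only: sum)
qed

theorem lemma6p8:
  fixes s1 :: "'k::{alg_closed_field, field_char_0} \<Rightarrow> 'v1::ab_group_add \<Rightarrow> 'v1"
    and s2 :: "'k \<Rightarrow> 'v2::ab_group_add \<Rightarrow> 'v2"
    and s3 :: "'k \<Rightarrow> 'v3::ab_group_add \<Rightarrow> 'v3"
    and B1 :: "'v1 set" and B2 :: "'v2 set" and B3 :: "'v3 set"
    and f1 :: "'v1 \<Rightarrow> int ^ 'r" and f2 :: "'v2 \<Rightarrow> int ^ 'r" and f3 :: "'v3 \<Rightarrow> int ^ 'r"
    and \<rho>1 :: "'k \<Rightarrow> 'v1 \<Rightarrow> 'v1" and \<rho>2 :: "'k \<Rightarrow> 'v2 \<Rightarrow> 'v2" and \<rho>3 :: "'k \<Rightarrow> 'v3 \<Rightarrow> 'v3"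
    and w1 w2 w3 :: "int ^ 'r \<Rightarrow> int"
    and T T' :: "('v1, 'v2, 'v3, 'k) tensor"
    and P :: "((int ^ 'r) \<times> (int ^ 'r) \<times> (int ^ 'r)) pmf"
    and N :: nat
  assumes "finite_dimensional_vector_space s1 B1"
    and "finite_dimensional_vector_space s2 B2"
    and "finite_dimensional_vector_space s3 B3"
    and "T \<in> tensor_space B1 B2 B3"
    and "mult_group_action s1 \<rho>1"
    and "mult_group_action s2 \<rho>2"
    and "mult_group_action s3 \<rho>3"
    and "\<And>t e. t \<noteq> 0 \<Longrightarrow> e \<in> B1 \<Longrightarrow> \<rho>1 t e = s1 (t powi w1 (f1 e)) e"
    and "\<And>t e. t \<noteq> 0 \<Longrightarrow> e \<in> B2 \<Longrightarrow> \<rho>2 t e = s2 (t powi w2 (f2 e)) e"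
    and "\<And>t e. t \<noteq> 0 \<Longrightarrow> e \<in> B3 \<Longrightarrow> \<rho>3 t e = s3 (t powi w3 (f3 e)) e"
    and "\<And>a1 a2 a3. (a1, a2, a3) \<in> block_support B1 B2 B3 f1 f2 f3 T \<Longrightarrow>
           w1 a1 + w2 a2 + w3 a3 \<ge> 0"
    and "tensor_limit_at_0
           (\<lambda>t. tensor_map s1 s2 s3 B1 B2 B3 (\<rho>1 t) (\<rho>2 t) (\<rho>3 t) T) T'"
    and "tight_blocking B1 B2 B3 f1 f2 f3 T'"
    and "set_pmf P \<subseteq> block_support B1 B2 B3 f1 f2 f3 T'"
    and "reconstructable (block_support B1 B2 B3 f1 f2 f3 T') P"
    and "marginal1 P = marginal2 P" and "marginal2 P = marginal3 P"
    and "N > 0"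
    and "\<And>a. real N * pmf P a \<in> \<int>"
    and "SP B1 B2 B3 f1 f2 f3 P N T' \<noteq> (\<lambda>_ _ _. 0)"
  shows "SP B1 B2 B3 f1 f2 f3 P N T = SP B1 B2 B3 f1 f2 f3 P N T'"
proof -
  let ?w = "\<lambda>x y z. w1 (f1 x) + w2 (f2 y) + w3 (f3 z)"
  let ?X = "typical_words B1 f1 (marginal1 P) N"
  let ?Y = "typical_words B2 f2 (marginal2 P) N"
  let ?Z = "typical_words B3 f3 (marginal3 P) N"
  let ?W = "\<lambda>xs ys zs. \<Sum>j<N. ?w (xs ! j) (ys ! j) (zs ! j)"
  have T': "T' x y z = (if ?w x y z = 0 then T x y z else 0)" for x y z
    by (rule toric_limit_entry[OF assms(1-4) assms(8-12)])
  have nonneg: "?w x y z \<ge> 0" if "T x y z \<noteq> 0" for x y z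
    using assms(11) block_support_nonzero_entry[OF assms(4) that] by blast
  \<comment> \<open>Since \<open>SP\<close> of \<open>T'\<close> is nonzero, there is a reference
    triple of words with which all other triples can be compared.\<close>
  obtain us vs ts where words: "us \<in> ?X" "vs \<in> ?Y" "ts \<in> ?Z"
    and ne: "kronecker_power N T' us vs ts \<noteq> 0"
    using assms(20) by (auto simp: SP_def coord_proj_def fun_eq_iff split: if_splits)
  have "T' (us ! j) (vs ! j) (ts ! j) \<noteq> 0" if "j < N" for j
    using ne that by (auto simp: kronecker_power_def split: if_splits)
  then have W0: "?W us vs ts = 0"
    by (intro sum.neutral) (metis T' lessThan_iff)
  have "kronecker_power N T xs ys zs = kronecker_power N T' xs ys zs"
    if "xs \<in> ?X" "ys \<in> ?Y" "zs \<in> ?Z" for xs ys zs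
  proof -
    \<comment> \<open>The total weight splits into one sum per tensor factor, which allows a
      different weight function on each.\<close>
    have "?W xs ys zs = ?W us vs ts"
      unfolding sum.distrib
      using typical_words_sum_eq[OF that(1) words(1), of w1]
        typical_words_sum_eq[OF that(2) words(2), of w2]
        typical_words_sum_eq[OF that(3) words(3), of w3] by simp
    then have W: "?W xs ys zs = 0"
      using W0 by simp
    have "(\<Prod>j<N. T (xs ! j) (ys ! j) (zs ! j)) = (\<Prod>j<N. T' (xs ! j) (ys ! j) (zs ! j))"
    \<comment> \<open>A vanishing factor of \<open>T\<close> also vanishes in \<open>T'\<close>, so
      both products are 0. Otherwise every weight is non-negative, and a zero total forces each of
      them to be 0, where \<open>T\<close> and \<open>T'\<close> agree.\<close>
    proof (cases "\<exists>j<N. T (xs ! j) (ys ! j) (zs ! j) = 0")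
      case True
      then have "\<exists>j<N. T' (xs ! j) (ys ! j) (zs ! j) = 0"
        using T' by auto
      then have "(\<Prod>j<N. T' (xs ! j) (ys ! j) (zs ! j)) = 0"
        by auto
      moreover have "(\<Prod>j<N. T (xs ! j) (ys ! j) (zs ! j)) = 0"
        using True by auto
      ultimately show ?thesis
        by (simp only:)
    next
      case False
      then have "\<forall>j\<in>{..<N}. ?w (xs ! j) (ys ! j) (zs ! j) = 0"
        using W sum_nonneg_eq_0_iff[of "{..<N}" "\<lambda>j. ?w (xs ! j) (ys ! j) (zs ! j)"] nonneg
        by blast
      then show ?thesis
        by (intro prod.cong) (auto simp: T')
    qed
    then show ?thesis
      by (simp add: kronecker_power_def)
  qed
  then show ?thesis
    by (auto simp: SP_def coord_proj_def fun_eq_iff)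
qed

end
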